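(* For every fixed integer $k\ge 2$, as $n\to\infty$, $$\left(\frac{1}{k^{1+1/k}}-o(1)\right)n^{1/k}\le m^0(n,\mathcal F_k)\le m^+(n,\mathcal C_{k,k})\le(2k+o(1))\,m^+(n,\mathcal F_k)\le(2k+o(1))\,n^{1/k}.$$
   Context: Digraphs have no loops and no parallel edges (opposite edges are allowed). A directed walk of length $k$ is a sequence $v_0v_1\cdots v_k$ of vertices with each $(v_i,v_{i+1})$ an edge. $\mathcal F_k$ is the family of all digraphs that are the union of two distinct directed walks of length $k$ having the same initial vertex and the same terminal vertex. $C_{\ell,\ell}$ is the digraph consisting of two vertices $x,y$ joined by two internally vertex-disjoint paths with $\ell$ edges each, both oriented from $x$ to $y$; $\mathcal C_{k,k}=\{C_{2,2},\ldots,C_{k,k}\}$. A digraph is $\mathcal F$-free if it has no subgraph isomorphic to a member of $\mathcal F$. For a family $\mathcal F$, $m^+(n,\mathcal F)$ (resp. $m^0(n,\mathcal F)$) is the largest possible minimum outdegree (resp. minimum semidegree $\min\{\delta^+,\delta^-\}$) of an $n$-vertex $\mathcal F$-free digraph. *)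

theory Defs
  imports
    Complex_Main
    "HOL-Library.Landau_Symbols"
    "Graph_Theory.Graph_Theory"
begin

text \<open>
  Digraphs without loops and parallel arcs are the finite structures satisfying
  \<^const>\<open>pair_digraph\<close>. A walk is given by its sequence of vertices (\<^const>\<open>vwalk\<close>); it may
  repeat vertices and arcs, and \<^const>\<open>vwalk_length\<close> counts its arcs.
\<close>

definition walk_union :: "'a vwalk \<Rightarrow> 'a vwalk \<Rightarrow> 'a pair_pre_digraph" where
  "walk_union p q =
    \<lparr> pverts = set p \<union> set q, parcs = set (vwalk_arcs p) \<union> set (vwalk_arcs q) \<rparr>"

definition two_walks :: "nat \<Rightarrow> 'a pair_pre_digraph set" where
  "two_walks k = {H. pair_digraph H \<and>
    (\<exists>p q. vwalk p (with_proj H) \<and> vwalk q (with_proj H) \<and>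
       vwalk_length p = k \<and> vwalk_length q = k \<and>
       p \<noteq> q \<and> hd p = hd q \<and> last p = last q \<and> H = walk_union p q)}"

text \<open>
  The isomorphism class of \<open>C\<^bsub>l,l\<^esub>\<close>. It is only meaningful for \<open>l \<ge> 2\<close>: for \<open>l = 1\<close> the two
  paths coincide.
\<close>

definition two_paths :: "nat \<Rightarrow> 'a pair_pre_digraph set" where
  "two_paths l = {H. pair_digraph H \<and>
    (\<exists>p q. vpath p (with_proj H) \<and> vpath q (with_proj H) \<and>
       vwalk_length p = l \<and> vwalk_length q = l \<and>
       hd p = hd q \<and> last p = last q \<and> set p \<inter> set q = {hd p, last p} \<and>
       H = walk_union p q)}"

definition two_paths_upto :: "nat \<Rightarrow> 'a pair_pre_digraph set" where
  "two_paths_upto k = (\<Union>l\<in>{2..k}. two_paths l)"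

definition free_of :: "'b pair_pre_digraph set \<Rightarrow> 'a pair_pre_digraph \<Rightarrow> bool" where
  "free_of F G \<longleftrightarrow>
    \<not> (\<exists>H\<in>F. \<exists>S. subgraph (with_proj S) (with_proj G) \<and> digraph_iso (with_proj S) (with_proj H))"

definition min_out_degree :: "'a pair_pre_digraph \<Rightarrow> nat" where
  "min_out_degree G = Min (out_degree (with_proj G) ` pverts G)"

definition min_in_degree :: "'a pair_pre_digraph \<Rightarrow> nat" where
  "min_in_degree G = Min (in_degree (with_proj G) ` pverts G)"

definition min_semidegree :: "'a pair_pre_digraph \<Rightarrow> nat" where
  "min_semidegree G = min (min_out_degree G) (min_in_degree G)"

text \<open>
  Every finite digraph is isomorphic to one on natural numbers, so it suffices to let both the
  hosts and the forbidden digraphs have vertices in \<^typ>\<open>nat\<close>. The maxima below are over finite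
  sets, as degrees are less than \<open>n\<close>; for \<open>n \<ge> 1\<close> these sets are nonempty as soon as
  every member of \<open>F\<close> has an arc.
\<close>

definition max_min_out_degree :: "nat \<Rightarrow> nat pair_pre_digraph set \<Rightarrow> nat" where
  "max_min_out_degree n F =
    Max {min_out_degree G | G :: nat pair_pre_digraph.
           pair_digraph G \<and> card (pverts G) = n \<and> free_of F G}"

definition max_min_semidegree :: "nat \<Rightarrow> nat pair_pre_digraph set \<Rightarrow> nat" where
  "max_min_semidegree n F =
    Max {min_semidegree G | G :: nat pair_pre_digraph.
           pair_digraph G \<and> card (pverts G) = n \<and> free_of F G}"

end

theory Submission
  imports Defs "HOL-Number_Theory.Cong"
begin

text \<open>
  Write \<open>x = n\<^bsup>1/k\<^esup>\<close>. The generalised de Bruijn digraph on \<open>\<int>/n\<close>, with arcs from \<open>i\<close> to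
  \<open>d i + r\<close> for \<open>0 \<le> r < d\<close>, has in- and outdegree \<open>d\<close>, and its walks of length \<open>k\<close> from \<open>i\<close> end in
  \<open>d\<^sup>k i + s\<close> with \<open>0 \<le> s < d\<^sup>k\<close>, where \<open>s\<close> determines the walk; so for \<open>d = \<lfloor>x\<rfloor>\<close> the end determines
  the walk. Deleting loops costs one in the degrees, so both extremal numbers for pairs of walks
  are at least \<open>x - 2\<close>; they are at most \<open>x\<close> because the walks of length \<open>k\<close> from a vertex have
  distinct ends. For pairs of disjoint paths, averaging over vertex colourings with \<open>k\<close> colours
  bounds the minimum outdegree by \<open>k x + k\<close>. Hence the inequalities even hold without error
  terms for large \<open>n\<close>.
\<close>

section \<open>Walks as vertex lists, and embeddings of digraphs\<close>

lemma vwalk_arcs_conv_zip: "vwalk_arcs p = zip p (tl p)"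
  by (induct p rule: vwalk_arcs.induct) auto

lemma vwalk_with_proj_iff:
  "vwalk p (with_proj G) \<longleftrightarrow>
    p \<noteq> [] \<and> set p \<subseteq> pverts G \<and> (\<forall>i. Suc i < length p \<longrightarrow> (p ! i, p ! Suc i) \<in> parcs G)"
proof -
  have "set (vwalk_arcs p) = {(p ! i, p ! Suc i) | i. Suc i < length p}"
    by (auto simp: vwalk_arcs_conv_zip set_zip nth_tl)
  then show ?thesis
    by (auto simp: vwalk_def)
qed

lemma vwalk_snoc_iff:
  assumes "p \<noteq> []" and "pair_digraph G"
  shows "vwalk (p @ [v]) (with_proj G) \<longleftrightarrow> vwalk p (with_proj G) \<and> (last p, v) \<in> parcs G"
proof -
  interpret pair_digraph G by fact
  show ?thesis
    using assms(1) in_arcsD2[of "last p" v]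
    by (auto simp: vwalk_def set_vwalk_arcs_snoc)
qed

lemma vwalk_map:
  assumes "vwalk p (with_proj H)" and "g ` pverts H \<subseteq> pverts G"
    and "\<And>u v. (u, v) \<in> parcs H \<Longrightarrow> (g u, g v) \<in> parcs G"
  shows "vwalk (map g p) (with_proj G)"
  unfolding vwalk_with_proj_iff
proof (intro conjI allI impI)
  show "set (map g p) \<subseteq> pverts G"
    using assms(1,2) by (auto simp: vwalk_def)
qed (use assms(1,3) in \<open>simp_all add: vwalk_with_proj_iff\<close>)

text \<open>The inverse of the vertex map of the isomorphism carries \<open>H\<close> into
  \<open>G\<close>. An isomorphism has a separate arc map, but since tails and heads are
  \<open>fst\<close> and \<open>snd\<close> on both sides, the vertex map already determines where
  each arc goes.\<close>

lemma digraph_iso_subgraph_embedding: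
  assumes "subgraph (with_proj S) (with_proj G)" and "digraph_iso (with_proj S) (with_proj H)"
  obtains g where "inj_on g (pverts H)" and "g ` pverts H \<subseteq> pverts G"
    and "\<And>u v. (u, v) \<in> parcs H \<Longrightarrow> (g u, g v) \<in> parcs G"
proof -
  obtain f where f: "pre_digraph.digraph_isomorphism (with_proj S) f"
    and H: "with_proj H = app_iso f (with_proj S)"
    using assms(2) by (auto simp: digraph_iso_def)
  have wf: "pair_wf_digraph S" and sub: "pverts S \<subseteq> pverts G" "parcs S \<subseteq> parcs G"
    using assms(1) by (auto simp: subgraph_def wf_digraph_wp_iff)
  have inj: "inj_on (iso_verts f) (pverts S)"
    and ends: "\<And>a. a \<in> parcs S \<Longrightarrow> iso_verts f (fst a) = iso_tail f (iso_arcs f a) \<and>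
        iso_verts f (snd a) = iso_head f (iso_arcs f a)"
    using f by (auto simp: pre_digraph.digraph_isomorphism_def)
  have V: "pverts H = iso_verts f ` pverts S" and A: "parcs H = iso_arcs f ` parcs S"
    and t: "iso_tail f = fst" and h: "iso_head f = snd"
    using arg_cong[OF H, of verts] arg_cong[OF H, of arcs] arg_cong[OF H, of tail]
      arg_cong[OF H, of head] by simp_all
  define g where "g = the_inv_into (pverts S) (iso_verts f)"
  have g: "g (iso_verts f u) = u" if "u \<in> pverts S" for u
    using that inj by (simp add: g_def the_inv_into_f_f)
  show ?thesis
  proof
    show "inj_on g (pverts H)"
      unfolding V by (rule inj_onI) (auto simp: g)
    show "g ` pverts H \<subseteq> pverts G"
      using sub by (auto simp: V g)
    fix u v assume "(u, v) \<in> parcs H"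
    then obtain a where a: "a \<in> parcs S" "(u, v) = iso_arcs f a"
      by (auto simp: A)
    have "u = iso_verts f (fst a)" "v = iso_verts f (snd a)"
      using ends[OF a(1)] a(2)[symmetric] by (simp_all add: t h)
    moreover have "fst a \<in> pverts S" "snd a \<in> pverts S"
      using pair_wf_digraph.arc_fst_in_verts[OF wf a(1)] pair_wf_digraph.arc_snd_in_verts[OF wf a(1)]
      by simp_all
    ultimately show "(g u, g v) \<in> parcs G"
      using a(1) sub g by auto
  qed
qed

lemma digraph_iso_refl:
  assumes "pair_digraph H"
  shows "digraph_iso (with_proj H) (with_proj H)"
proof -
  interpret pair_digraph H by fact
  have "wf_digraph (with_proj H)" by unfold_locales
  then show ?thesis
    unfolding digraph_iso_def
    by (intro exI[of _ "\<lparr>iso_verts = id, iso_arcs = id, iso_head = snd, iso_tail = fst\<rparr>"])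
      (auto simp: pre_digraph.digraph_isomorphism_def app_iso_def with_proj_def)
qed

text \<open>The union of two walks of \<open>G\<close> is a legitimate loopless digraph inside
  \<open>G\<close>, so it can serve both as a forbidden digraph and as its own copy.\<close>

lemma walk_union_subgraph:
  assumes "pair_digraph G" and "vwalk p (with_proj G)" and "vwalk q (with_proj G)"
  shows "pair_digraph (walk_union p q)"
    and "subgraph (with_proj (walk_union p q)) (with_proj G)"
    and "vwalk p (with_proj (walk_union p q))" and "vwalk q (with_proj (walk_union p q))"
proof -
  interpret pair_digraph G by fact
  have sub: "set (vwalk_arcs r) \<subseteq> parcs G" "set r \<subseteq> pverts G" "r \<noteq> []" if "r \<in> {p, q}" for r
    using assms(2,3) that by (auto simp: vwalk_def)
  have in_set: "a \<in> set r \<and> b \<in> set r" if "(a, b) \<in> set (vwalk_arcs r)" for a b and r :: "'a list"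
    using that by (cases r) (auto simp: vwalk_arcs_conv_zip dest: set_zip_leftD set_zip_rightD)
  show *: "pair_digraph (walk_union p q)"
  proof
    fix e assume "e \<in> parcs (walk_union p q)"
    then obtain r where r: "r \<in> {p, q}" "(fst e, snd e) \<in> set (vwalk_arcs r)"
      by (auto simp: walk_union_def)
    then show "fst e \<in> pverts (walk_union p q)" "snd e \<in> pverts (walk_union p q)"
      using in_set[OF r(2)] by (auto simp: walk_union_def)
    show "fst e \<noteq> snd e"
      using sub(1)[OF r(1)] r(2) no_loops' by blast
  qed (auto simp: walk_union_def)
  interpret H: pair_digraph "walk_union p q" by fact
  have "wf_digraph (with_proj G)" "wf_digraph (with_proj (walk_union p q))"
    by unfold_locales
  then show "subgraph (with_proj (walk_union p q)) (with_proj G)"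
    using sub by (auto simp: subgraph_def walk_union_def compatible_def)
  show "vwalk p (with_proj (walk_union p q))" "vwalk q (with_proj (walk_union p q))"
    using sub by (auto simp: vwalk_def walk_union_def)
qed

section \<open>Freeness expressed by walks and paths of the host\<close>

text \<open>Two offending walks give the forbidden digraph \<open>walk_union p q\<close>, which is a
  subgraph of \<open>G\<close> itself; this is why the family is taken over the vertex type of
  \<open>G\<close>. Conversely, an embedding is injective and keeps distinct walks distinct.\<close>

lemma free_of_two_walks_iff:
  fixes G :: "'a pair_pre_digraph"
  assumes G: "pair_digraph G"
  shows "free_of (two_walks k :: 'a pair_pre_digraph set) G \<longleftrightarrow>
    (\<forall>p q. vwalk p (with_proj G) \<longrightarrow> vwalk q (with_proj G) \<longrightarrow> length p = Suc k \<longrightarrow>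
      length q = Suc k \<longrightarrow> hd p = hd q \<longrightarrow> last p = last q \<longrightarrow> p = q)"
    (is "_ \<longleftrightarrow> ?unique")
proof
  assume free: "free_of (two_walks k :: 'a pair_pre_digraph set) G"
  show ?unique
  proof (intro allI impI, rule ccontr)
    fix p q assume pq: "vwalk p (with_proj G)" "vwalk q (with_proj G)" "length p = Suc k"
      "length q = Suc k" "hd p = hd q" "last p = last q" "p \<noteq> q"
    note U = walk_union_subgraph[OF G pq(1,2)]
    have "walk_union p q \<in> two_walks k"
      unfolding two_walks_def mem_Collect_eq
      by (intro conjI exI[of _ p] exI[of _ q]) (use pq U in simp_all)
    then show False
      using free U(2) digraph_iso_refl[OF U(1)] by (auto simp: free_of_def)
  qed
next
  assume uniq: ?unique
  show "free_of (two_walks k :: 'a pair_pre_digraph set) G"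
    unfolding free_of_def
  proof (safe)
    fix H :: "'a pair_pre_digraph" and S
    assume H: "H \<in> two_walks k" and S: "subgraph (with_proj S) (with_proj G)"
      "digraph_iso (with_proj S) (with_proj H)"
    obtain g where g: "inj_on g (pverts H)" "g ` pverts H \<subseteq> pverts G"
      "\<And>u v. (u, v) \<in> parcs H \<Longrightarrow> (g u, g v) \<in> parcs G"
      using digraph_iso_subgraph_embedding[OF S] by metis
    obtain p q where pq: "vwalk p (with_proj H)" "vwalk q (with_proj H)"
      "length p - 1 = k" "length q - 1 = k" "p \<noteq> q" "hd p = hd q" "last p = last q"
      using H by (auto simp: two_walks_def)
    have ne: "p \<noteq> []" "q \<noteq> []" and sub: "set p \<union> set q \<subseteq> pverts H"
      using pq(1,2) by (auto simp: vwalk_def)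
    \<comment> \<open>Subtraction is truncated, so \<open>length p - 1 = k\<close> fixes the number
      of vertices only once \<open>p\<close> is nonempty.\<close>
    have len: "length p = Suc k" "length q = Suc k"
      using ne[folded length_greater_0_conv] pq(3,4) by linarith+
    have "map g p = map g q"
      by (rule uniq[rule_format, OF vwalk_map[OF pq(1) g(2,3)] vwalk_map[OF pq(2) g(2,3)]])
        (use len pq(6,7) ne in \<open>simp_all add: hd_map last_map\<close>)
    moreover have "inj_on g (set p \<union> set q)"
      using g(1) sub by (rule inj_on_subset)
    ultimately show False
      using pq(5) map_inj_on by blast
  qed
qed

text \<open>The argument is the same as for walks; injectivity now also preserves distinctness of
  vertices and the intersection of the two paths. Lists of \<open>3\<close> to \<open>Suc k\<close>
  vertices have \<open>2\<close> to \<open>k\<close> arcs.\<close>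

lemma free_of_two_paths_upto_iff:
  fixes G :: "'a pair_pre_digraph"
  assumes G: "pair_digraph G"
  shows "free_of (two_paths_upto k :: 'a pair_pre_digraph set) G \<longleftrightarrow>
    (\<forall>p q. vpath p (with_proj G) \<longrightarrow> vpath q (with_proj G) \<longrightarrow> length p = length q \<longrightarrow>
      length p \<in> {3..Suc k} \<longrightarrow> hd p = hd q \<longrightarrow> last p = last q \<longrightarrow>
      set p \<inter> set q \<noteq> {hd p, last p})"
    (is "_ \<longleftrightarrow> ?none")
proof
  assume free: "free_of (two_paths_upto k :: 'a pair_pre_digraph set) G"
  show ?none
  proof (intro allI impI notI)
    fix p q assume pq: "vpath p (with_proj G)" "vpath q (with_proj G)" "length p = length q"
      "length p \<in> {3..Suc k}" "hd p = hd q" "last p = last q" "set p \<inter> set q = {hd p, last p}"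
    have w: "vwalk p (with_proj G)" "vwalk q (with_proj G)" "distinct p" "distinct q"
      using pq by (auto simp: vpath_def)
    note U = walk_union_subgraph[OF G w(1,2)]
    have "walk_union p q \<in> two_paths (length p - 1)"
      unfolding two_paths_def vpath_def mem_Collect_eq
      by (intro conjI exI[of _ p] exI[of _ q]) (use pq U w in simp_all)
    then have "walk_union p q \<in> two_paths_upto k"
      unfolding two_paths_upto_def using pq(4) by (intro UN_I[of "length p - 1"]) auto
    then show False
      using free U(2) digraph_iso_refl[OF U(1)] by (auto simp: free_of_def)
  qed
next
  assume none: ?none
  show "free_of (two_paths_upto k :: 'a pair_pre_digraph set) G"
    unfolding free_of_def
  proof (safe)
    fix H :: "'a pair_pre_digraph" and S
    assume H: "H \<in> two_paths_upto k" and S: "subgraph (with_proj S) (with_proj G)"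
      "digraph_iso (with_proj S) (with_proj H)"
    obtain g where g: "inj_on g (pverts H)" "g ` pverts H \<subseteq> pverts G"
      "\<And>u v. (u, v) \<in> parcs H \<Longrightarrow> (g u, g v) \<in> parcs G"
      using digraph_iso_subgraph_embedding[OF S] by metis
    obtain l p q where pq: "vwalk p (with_proj H)" "vwalk q (with_proj H)" "distinct p" "distinct q"
      "length p - 1 = l" "length q - 1 = l" "l \<in> {2..k}" "hd p = hd q" "last p = last q"
      "set p \<inter> set q = {hd p, last p}"
      using H by (auto simp: two_paths_upto_def two_paths_def vpath_def)
    have ne: "p \<noteq> []" "q \<noteq> []" and sub: "set p \<subseteq> pverts H" "set q \<subseteq> pverts H"
      using pq(1,2) by (auto simp: vwalk_def)
    have len: "length p = Suc l" "length q = Suc l"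
      using ne[folded length_greater_0_conv] pq(5,6) by linarith+
    have "vpath (map g p) (with_proj G)" "vpath (map g q) (with_proj G)"
      unfolding vpath_def distinct_map
      by (intro conjI vwalk_map[OF _ g(2,3)] pq inj_on_subset[OF g(1)] sub; assumption)+
    moreover have "set (map g p) \<inter> set (map g q) = {hd (map g p), last (map g p)}"
      using inj_on_image_Int[OF g(1) sub] pq(10) ne by (simp add: hd_map last_map)
    moreover have "hd (map g p) = hd (map g q)" "last (map g p) = last (map g q)"
      using pq(8,9) ne by (simp_all add: hd_map last_map)
    moreover have "length (map g p) \<in> {3..Suc k}" "length (map g p) = length (map g q)"
      using len pq(7) by auto
    ultimately show False
      using none by blast
  qed
qed

section \<open>Degrees and the number of walks from a vertex\<close>

lemma out_degree_with_proj: "out_degree (with_proj G) v = card {w. (v, w) \<in> parcs G}"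
proof -
  have "out_arcs (with_proj G) v = Pair v ` {w. (v, w) \<in> parcs G}"
    by (auto simp: out_arcs_def)
  then show ?thesis
    by (simp add: out_degree_def card_image inj_on_def)
qed

lemma in_degree_with_proj: "in_degree (with_proj G) v = card {u. (u, v) \<in> parcs G}"
proof -
  have "in_arcs (with_proj G) v = (\<lambda>u. (u, v)) ` {u. (u, v) \<in> parcs G}"
    by (auto simp: in_arcs_def)
  then show ?thesis
    by (simp add: in_degree_def card_image inj_on_def)
qed

lemma min_out_degree_le:
  assumes "pair_digraph G" and "v \<in> pverts G"
  shows "min_out_degree G \<le> card {w. (v, w) \<in> parcs G}"
proof -
  interpret pair_digraph G by fact
  show ?thesis
    using assms(2) pair_finite_verts by (auto simp: min_out_degree_def simp flip: out_degree_with_proj)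
qed

lemma min_out_degree_le_card:
  assumes "pair_digraph G" and "pverts G \<noteq> {}"
  shows "min_out_degree G \<le> card (pverts G)"
proof -
  interpret pair_digraph G by fact
  obtain v where v: "v \<in> pverts G" using assms(2) by blast
  have "card {w. (v, w) \<in> parcs G} \<le> card (pverts G)"
    by (rule card_mono[OF pair_finite_verts]) (auto dest: in_arcsD2)
  then show ?thesis
    using min_out_degree_le[OF assms(1) v] by simp
qed

text \<open>A list determines its last entry and the list before it, so extensions of different
  lists never coincide and each level is at least \<open>m\<close> times as large as the one before.
  This serves for walks and, with a smaller \<open>m\<close>, for paths.\<close>

lemma power_le_card_extensions:
  fixes L :: "nat \<Rightarrow> 'a list set"
  assumes fin: "\<And>j. finite (L j)" and "L 0 \<noteq> {}"
    and ext: "\<And>j p. j < k \<Longrightarrow> p \<in> L j \<Longrightarrow> m \<le> card {v. p @ [v] \<in> L (Suc j)}"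
  shows "m ^ k \<le> card (L k)"
  using ext
proof (induct k)
  case 0
  have "0 < card (L 0)"
    using assms(1,2) by (simp add: card_gt_0_iff)
  then show ?case by simp
next
  case (Suc k)
  let ?E = "\<lambda>p. {v. p @ [v] \<in> L (Suc k)}"
  have finE: "finite (?E p)" for p
    using finite_vimageI[OF fin[of "Suc k"], of "\<lambda>v. p @ [v]"] by (simp add: vimage_def inj_def)
  have "m ^ Suc k \<le> card (L k) * m"
    using Suc by simp
  also have "\<dots> = (\<Sum>p\<in>L k. m)" by simp
  also have "\<dots> \<le> (\<Sum>p\<in>L k. card (?E p))"
    by (rule sum_mono) (use Suc.prems in auto)
  also have "\<dots> = card (SIGMA p:L k. ?E p)"
    using fin finE by simp
  also have "\<dots> = card ((\<lambda>(p, v). p @ [v]) ` (SIGMA p:L k. ?E p))"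
    by (rule card_image[symmetric]) (auto simp: inj_on_def)
  also have "\<dots> \<le> card (L (Suc k))"
    by (rule card_mono[OF fin]) auto
  finally show ?case .
qed

lemma finite_vwalks_of_length:
  assumes "pair_digraph G"
  shows "finite {p. vwalk p (with_proj G) \<and> length p = n}"
proof -
  interpret pair_digraph G by fact
  show ?thesis
    by (rule finite_subset[OF _ finite_lists_length_eq[OF pair_finite_verts, of n]])
      (auto simp: vwalk_def)
qed

text \<open>Walks of length \<open>k\<close> are counted from one fixed vertex \<open>x\<close>;
  freeness makes \<open>last\<close> injective on them.\<close>

lemma min_out_degree_power_le_card:
  assumes G: "pair_digraph G" and ne: "pverts G \<noteq> {}"
    and free: "free_of (two_walks k :: 'a pair_pre_digraph set) (G :: 'a pair_pre_digraph)"
  shows "min_out_degree G ^ k \<le> card (pverts G)"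
proof -
  interpret pair_digraph G by fact
  obtain x where x: "x \<in> pverts G" using ne by blast
  define L where "L j = {p. vwalk p (with_proj G) \<and> length p = Suc j \<and> hd p = x}" for j
  have fin: "finite (L j)" for j
    by (rule finite_subset[OF _ finite_vwalks_of_length[OF G, of "Suc j"]]) (auto simp: L_def)
  have "[x] \<in> L 0"
    using x by (auto simp: L_def vwalk_def)
  then have "min_out_degree G ^ k \<le> card (L k)"
  proof (intro power_le_card_extensions fin)
    fix j p assume p: "p \<in> L j"
    then have "p \<noteq> []" "last p \<in> pverts G"
      by (auto simp: L_def vwalk_def)
    then have "{v. p @ [v] \<in> L (Suc j)} = {v. (last p, v) \<in> parcs G}"
      using p vwalk_snoc_iff[OF _ G] by (auto simp: L_def)
    then show "min_out_degree G \<le> card {v. p @ [v] \<in> L (Suc j)}"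
      using min_out_degree_le[OF G \<open>last p \<in> pverts G\<close>] by simp
  qed auto
  also have "\<dots> = card (last ` L k)"
    using free[unfolded free_of_two_walks_iff[OF G]]
    by (intro card_image[symmetric] inj_onI) (auto simp: L_def)
  also have "\<dots> \<le> card (pverts G)"
    by (rule card_mono[OF pair_finite_verts]) (auto simp: L_def vwalk_def)
  finally show ?thesis .
qed

section \<open>From pairs of disjoint paths to pairs of walks\<close>

text \<open>Both walks are prolonged by the same out-neighbour of their common end, which exists
  because the minimum outdegree is positive.\<close>

lemma distinct_vwalks_extend:
  assumes G: "pair_digraph G" and "0 < min_out_degree G"
    and "vwalk p (with_proj G)" "vwalk q (with_proj G)" "length p = Suc l" "length q = Suc l"
    "hd p = hd q" "last p = last q" "p \<noteq> q"
  shows "\<exists>p' q'. vwalk p' (with_proj G) \<and> vwalk q' (with_proj G) \<and>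
    length p' = Suc (l + m) \<and> length q' = Suc (l + m) \<and> hd p' = hd q' \<and> last p' = last q' \<and> p' \<noteq> q'"
proof (induct m)
  case 0
  show ?case
    unfolding add_0_right by (intro exI[of _ p] exI[of _ q] conjI assms(3-9))
next
  case (Suc m)
  then obtain p' q' where pq: "vwalk p' (with_proj G)" "vwalk q' (with_proj G)"
    "length p' = Suc (l + m)" "length q' = Suc (l + m)" "hd p' = hd q'" "last p' = last q'" "p' \<noteq> q'"
    by blast
  have ne: "p' \<noteq> []" "q' \<noteq> []" and "last p' \<in> pverts G"
    using pq by (auto simp: vwalk_def)
  then have "0 < card {w. (last p', w) \<in> parcs G}"
    using min_out_degree_le[OF G] assms(2) order_less_le_trans by blast
  then obtain w where "(last p', w) \<in> parcs G"
    by (auto simp: card_gt_0_iff)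
  then have "vwalk (p' @ [w]) (with_proj G)" "vwalk (q' @ [w]) (with_proj G)"
    using pq(1,2,6) vwalk_snoc_iff[OF ne(1) G] vwalk_snoc_iff[OF ne(2) G] by simp_all
  then show ?case
    by (intro exI[of _ "p' @ [w]"] exI[of _ "q' @ [w]"] conjI)
      (use pq(3-7) ne in simp_all)
qed

text \<open>Two disjoint paths may be shorter than \<open>k\<close>, so they are prolonged to
  distinct walks of length exactly \<open>k\<close>.\<close>

lemma free_of_two_walks_imp_two_paths_upto:
  fixes G :: "'a pair_pre_digraph"
  assumes G: "pair_digraph G" and "0 < min_out_degree G"
    and free: "free_of (two_walks k :: 'a pair_pre_digraph set) G"
  shows "free_of (two_paths_upto k :: 'a pair_pre_digraph set) G"
  unfolding free_of_two_paths_upto_iff[OF G]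
proof (intro allI impI notI)
  fix p q assume pq: "vpath p (with_proj G)" "vpath q (with_proj G)" "length p = length q"
    "length p \<in> {3..Suc k}" "hd p = hd q" "last p = last q" "set p \<inter> set q = {hd p, last p}"
  have w: "vwalk p (with_proj G)" "vwalk q (with_proj G)" "distinct p"
    using pq by (auto simp: vpath_def)
  \<comment> \<open>If \<open>p = q\<close>, the intersection would contain at least three vertices
    instead of only the ends.\<close>
  have "card {hd p, last p} \<le> 2"
    by (simp add: card_insert_if)
  moreover have "card (set p) \<ge> 3"
    using w(3) pq(4) by (simp add: distinct_card)
  ultimately have "p \<noteq> q"
    using pq(7) by auto
  moreover have "length p = Suc (length p - 1)" "length q = Suc (length p - 1)"
    "(length p - 1) + (k - (length p - 1)) = k"
    using pq(3,4) by auto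
  ultimately obtain p' q' where "vwalk p' (with_proj G)" "vwalk q' (with_proj G)"
    "length p' = Suc k" "length q' = Suc k" "hd p' = hd q'" "last p' = last q'" "p' \<noteq> q'"
    using distinct_vwalks_extend[OF G assms(2) w(1,2), of "length p - 1" "k - (length p - 1)"] pq(5,6)
    by metis
  then show False
    using free[unfolded free_of_two_walks_iff[OF G]] by blast
qed

section \<open>Upper bound for hosts without pairs of disjoint paths\<close>

lemma vpath_map_nth_upt:
  assumes p: "vpath p (with_proj G)" and "a \<le> b" "b < length p"
  shows "vpath (map ((!) p) [a..<Suc b]) (with_proj G)"
proof -
  have "distinct (map ((!) p) [a..<Suc b])"
    using assms by (auto simp: vpath_def distinct_map inj_on_def nth_eq_iff_index_eq)
  moreover have "vwalk (map ((!) p) [a..<Suc b]) (with_proj G)"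
    using assms by (auto simp: vpath_def vwalk_with_proj_iff nth_append subset_iff simp del: upt_Suc)
  ultimately show ?thesis
    by (simp add: vpath_def)
qed

text \<open>Let \<open>i\<close> be the first position where the paths differ and \<open>j\<close>
  the next one where they agree. Cutting both paths from \<open>i - 1\<close> to \<open>j\<close>
  gives segments of equal length. By \<open>meet\<close> a common vertex sits at the same position
  in both, so the segments share only their ends.\<close>

lemma two_paths_upto_free_imp_paths_eq:
  fixes G :: "'a pair_pre_digraph"
  assumes G: "pair_digraph G" and free: "free_of (two_paths_upto k :: 'a pair_pre_digraph set) G"
    and pq: "vpath p (with_proj G)" "vpath q (with_proj G)" "length p = Suc k" "length q = Suc k"
      "hd p = hd q" "last p = last q"
    and meet: "\<And>i j. i \<le> k \<Longrightarrow> j \<le> k \<Longrightarrow> p ! i = q ! j \<Longrightarrow> i = j"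
  shows "p = q"
proof (rule ccontr)
  assume "p \<noteq> q"
  then have ex: "\<exists>i. i \<le> k \<and> p ! i \<noteq> q ! i"
    using pq(3,4) nth_equalityI[of p q] by (metis less_Suc_eq_le)
  define i where "i = (LEAST i. i \<le> k \<and> p ! i \<noteq> q ! i)"
  have "i \<le> k \<and> p ! i \<noteq> q ! i"
    unfolding i_def by (rule LeastI_ex[OF ex])
  then have i: "i \<le> k" "p ! i \<noteq> q ! i" by simp_all
  have i_least: "p ! s = q ! s" if "s < i" "s \<le> k" for s
    using not_less_Least[OF that(1)[unfolded i_def]] that(2) by blast
  have ne: "p \<noteq> []" "q \<noteq> []"
    using pq(3,4) by auto
  have "p ! 0 = q ! 0" and pk: "p ! k = q ! k"
    using pq(3-6) ne by (simp_all add: hd_conv_nth last_conv_nth)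
  then obtain a where a: "i = Suc a"
    using i(2) by (cases i) auto
  have "i < k"
    using i pk by (cases "i = k") auto
  define j where "j = (LEAST j. i < j \<and> p ! j = q ! j)"
  have ex': "\<exists>j. i < j \<and> p ! j = q ! j"
    using \<open>i < k\<close> pk by blast
  have "i < j \<and> p ! j = q ! j"
    unfolding j_def by (rule LeastI_ex[OF ex'])
  then have j: "i < j" "p ! j = q ! j" by simp_all
  have "j \<le> k"
    unfolding j_def using \<open>i < k\<close> pk by (intro Least_le conjI)
  have j_least: "p ! s \<noteq> q ! s" if "i < s" "s < j" for s
    using not_less_Least[OF that(2)[unfolded j_def]] that(1) by blast
  define P where "P = map ((!) p) [a..<Suc j]"
  define Q where "Q = map ((!) q) [a..<Suc j]"
  have PQ: "vpath P (with_proj G)" "vpath Q (with_proj G)"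
    unfolding P_def Q_def using pq(3,4) a j(1) \<open>j \<le> k\<close>
    by (auto intro!: vpath_map_nth_upt pq(1,2) simp del: upt_Suc)
  \<comment> \<open>From \<open>a < i < j \<le> k\<close> the segments have at least two and at most
    \<open>k\<close> arcs.\<close>
  have len: "length P = length Q" "length P \<in> {3..Suc k}"
    using a j(1) \<open>j \<le> k\<close> by (auto simp: P_def Q_def)
  have hdP: "hd P = p ! a" "hd Q = q ! a" "last P = p ! j" "last Q = q ! j"
    using a j(1) by (auto simp: P_def Q_def hd_map hd_append)
  have eq_a: "p ! a = q ! a"
    using i_least[of a] a i(1) by simp
  have inter: "set P \<inter> set Q = {p ! a, p ! j}"
  proof
    show "{p ! a, p ! j} \<subseteq> set P \<inter> set Q"
    proof -
      have "a \<in> set [a..<Suc j]" "j \<in> set [a..<Suc j]"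
        using a j(1) by simp_all
      then show ?thesis
        unfolding P_def Q_def set_map using eq_a j(2) by blast
    qed
    show "set P \<inter> set Q \<subseteq> {p ! a, p ! j}"
    proof
      fix v assume "v \<in> set P \<inter> set Q"
      then obtain s t where st: "a \<le> s" "s \<le> j" "a \<le> t" "t \<le> j" "v = p ! s" "v = q ! t"
        by (auto simp: P_def Q_def simp del: upt_Suc)
      then have "s = t"
        using assms(9) \<open>j \<le> k\<close> by auto
      then have "s = a \<or> s = j"
        using st j_least[of s] i(2) a by (cases "s = i"; cases "i < s"; cases "s < j") auto
      then show "v \<in> {p ! a, p ! j}"
        using st by auto
    qed
  qed
  have "hd P = hd Q" "last P = last Q"
    unfolding hdP by (rule eq_a, rule j(2))
  then have "set P \<inter> set Q \<noteq> {hd P, last P}"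
    by (rule free[unfolded free_of_two_paths_upto_iff[OF G], rule_format, OF PQ len])
  then show False
    unfolding hdP using inter by contradiction
qed

text \<open>
  Averaging over all colourings of the vertices with colours \<open>1, \<dots>, k\<close>: a path of length \<open>k\<close> from
  \<open>x\<close> has its \<open>i\<close>-th vertex coloured \<open>i\<close> for a fraction \<open>k\<^sup>-\<^sup>k\<close> of the colourings, whereas for
  a fixed colouring the paths coloured in this way have distinct ends.
\<close>

lemma two_paths_upto_free_degree_bound:
  fixes G :: "'a pair_pre_digraph"
  assumes G: "pair_digraph G" and ne: "pverts G \<noteq> {}" and k: "0 < k"
    and free: "free_of (two_paths_upto k :: 'a pair_pre_digraph set) G"
  shows "(min_out_degree G - k) ^ k \<le> card (pverts G) * k ^ k"
proof -
  interpret pair_digraph G by fact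
  let ?V = "pverts G"
  obtain x where x: "x \<in> ?V" using ne by blast
  define L where "L j = {p. vpath p (with_proj G) \<and> length p = Suc j \<and> hd p = x}" for j
  have fin: "finite (L j)" for j
    by (rule finite_subset[OF _ finite_vwalks_of_length[OF G, of "Suc j"]])
      (auto simp: L_def vpath_def)
  have "[x] \<in> L 0"
    using x by (auto simp: L_def vpath_def vwalk_def)
  then have paths: "(min_out_degree G - k) ^ k \<le> card (L k)"
  proof (intro power_le_card_extensions fin)
    fix j p assume "j < k" and p: "p \<in> L j"
    then have "p \<noteq> []" and last: "last p \<in> ?V"
      by (auto simp: L_def vpath_def vwalk_def)
    then have "{v. p @ [v] \<in> L (Suc j)} = {v. (last p, v) \<in> parcs G} - set p"
      using p vwalk_snoc_iff[OF _ G] by (auto simp: L_def vpath_def)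
    \<comment> \<open>Staying a path forbids only the at most \<open>k\<close> vertices already
      visited, hence the loss of \<open>k\<close> in the degree.\<close>
    moreover have "card (set p) \<le> k"
      using p \<open>j < k\<close> card_length[of p] by (simp add: L_def)
    ultimately show "min_out_degree G - k \<le> card {v. p @ [v] \<in> L (Suc j)}"
      using min_out_degree_le[OF G last] diff_card_le_card_Diff[of "set p" "{v. (last p, v) \<in> parcs G}"]
      by simp
  qed auto
  define C where "C = ?V \<rightarrow>\<^sub>E {1..k}"
  \<comment> \<open>Position \<open>0\<close> is left uncoloured: it holds the start
    \<open>x\<close>, common to all paths of \<open>L k\<close>.\<close>
  define R where "R p c \<longleftrightarrow> (\<forall>i\<in>{1..k}. c (p ! i) = i)" for p :: "'a list" and c :: "'a \<Rightarrow> nat"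
  have finC: "finite C" and cardC: "card C = k ^ card ?V"
    using pair_finite_verts by (simp_all add: C_def finite_PiE card_PiE)
  have many: "k ^ card ?V \<le> k ^ k * card {c \<in> C. R p c}" if p: "p \<in> L k" for p
  proof -
    define T where "T = (!) p ` {1..k}"
    \<comment> \<open>These are the colours allowed at \<open>v\<close>: its position if
      \<open>v\<close> lies in \<open>T\<close>, and every colour otherwise, when the implication is
      vacuous.\<close>
    define B where "B v = {i \<in> {1..k}. \<forall>j\<in>{1..k}. p ! j = v \<longrightarrow> i = j}" for v
    have dist: "distinct p" "length p = Suc k" "set p \<subseteq> ?V"
      using p by (auto simp: L_def vpath_def vwalk_def)
    have "inj_on ((!) p) {1..k}"
      using dist by (auto simp: inj_on_def nth_eq_iff_index_eq)
    then have cardT: "card T = k"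
      by (simp add: T_def card_image)
    have TV: "T \<subseteq> ?V"
      using dist by (auto simp: T_def)
    have B_T: "card (B v) = 1" if v: "v \<in> T" for v
    proof -
      obtain i where i: "i \<in> {1..k}" "v = p ! i"
        using v by (auto simp: T_def)
      then have "B v = {i}"
        using dist by (auto simp: B_def nth_eq_iff_index_eq)
      then show ?thesis by simp
    qed
    have B_not_T: "card (B v) = k" if "v \<notin> T" for v
    proof -
      have "B v = {1..k}"
        using that by (auto simp: B_def T_def)
      then show ?thesis by simp
    qed
    have "k ^ card ?V = (\<Prod>v\<in>?V. k)"
      by simp
    \<comment> \<open>Each factor \<open>k\<close> is split so that the \<open>k\<close> vertices of
      \<open>T\<close> contribute the loss \<open>k ^ k\<close> and the rest counts the colourings
      in \<open>PiE ?V B\<close>.\<close>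
    also have "\<dots> = (\<Prod>v\<in>?V. (if v \<in> T then k else 1) * card (B v))"
      by (rule prod.cong) (simp_all add: B_T B_not_T)
    also have "\<dots> = (\<Prod>v\<in>?V. if v \<in> T then k else 1) * (\<Prod>v\<in>?V. card (B v))"
      by (rule prod.distrib)
    also have "(\<Prod>v\<in>?V. if v \<in> T then k else 1) = k ^ card (?V \<inter> T)"
      using prod.inter_restrict[OF pair_finite_verts, of "\<lambda>_. k" T] by simp
    also have "?V \<inter> T = T" using TV by blast
    also have "(\<Prod>v\<in>?V. card (B v)) = card (PiE ?V B)"
      using pair_finite_verts by (simp add: card_PiE)
    also have "\<dots> \<le> card {c \<in> C. R p c}"
    proof (rule card_mono)
      show "PiE ?V B \<subseteq> {c \<in> C. R p c}"
      proof
        fix c assume c: "c \<in> PiE ?V B"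
        have "c \<in> C"
          unfolding C_def using c by (rule subsetD[OF PiE_mono, rotated]) (auto simp: B_def)
        moreover have "c (p ! i) = i" if "i \<in> {1..k}" for i
        proof -
          have "p ! i \<in> ?V"
            using TV that by (auto simp: T_def)
          then have "c (p ! i) \<in> B (p ! i)"
            using c by (rule PiE_mem[rotated])
          then show ?thesis
            using that by (auto simp: B_def)
        qed
        ultimately show "c \<in> {c \<in> C. R p c}"
          by (simp add: R_def)
      qed
    qed (use finC in simp)
    finally show ?thesis
      using cardT by simp
  qed
  have few: "card {p \<in> L k. R p c} \<le> card ?V" if "c \<in> C" for c
  proof (rule card_inj_on_le[OF _ _ pair_finite_verts])
    show "last ` {p \<in> L k. R p c} \<subseteq> ?V"
      by (auto simp: L_def vpath_def vwalk_def)
    show "inj_on last {p \<in> L k. R p c}"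
    proof (rule inj_onI)
      fix p q assume p: "p \<in> {p \<in> L k. R p c}" and q: "q \<in> {p \<in> L k. R p c}" and l: "last p = last q"
      have d: "distinct p" "distinct q" "length p = Suc k" "length q = Suc k" "hd p = hd q"
        using p q by (auto simp: L_def vpath_def)
      then have start: "p ! 0 = q ! 0"
        by (metis hd_conv_nth list.size(3) nat.distinct(1))
      have colour: "c (p ! i) = i" "c (q ! i) = i" if "0 < i" "i \<le> k" for i
        using p q that by (auto simp: R_def)
      \<comment> \<open>A shared vertex has one colour, which is its position on either path. For
        position \<open>0\<close> the common start and distinctness replace the colour.\<close>
      have "i = j" if "i \<le> k" "j \<le> k" "p ! i = q ! j" for i j
      proof (cases "i = 0 \<or> j = 0")
        case True
        then show ?thesis
          using that d start nth_eq_iff_index_eq[of p i 0] nth_eq_iff_index_eq[of q 0 j] by auto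
      next
        case False
        then show ?thesis
          using that colour[of i] colour[of j] by simp
      qed
      then show "p = q"
        using two_paths_upto_free_imp_paths_eq[OF G free, of p q] p q l by (auto simp: L_def)
    qed
  qed
  \<comment> \<open>The pairs \<open>(p, c)\<close> with \<open>R p c\<close> are counted in both
    orders; the number \<open>k ^ card ?V\<close> of colourings cancels in the end.\<close>
  have "card (L k) * k ^ card ?V = (\<Sum>p\<in>L k. k ^ card ?V)" by simp
  also have "\<dots> \<le> (\<Sum>p\<in>L k. k ^ k * card {c \<in> C. R p c})"
    by (rule sum_mono) (rule many)
  also have "\<dots> = k ^ k * (\<Sum>p\<in>L k. card {c \<in> C. R p c})"
    by (simp add: sum_distrib_left)
  also have "(\<Sum>p\<in>L k. card {c \<in> C. R p c}) = (\<Sum>c\<in>C. card {p \<in> L k. R p c})"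
    by (rule sum_multicount_gen) (use fin finC in auto)
  also have "\<dots> \<le> (\<Sum>c\<in>C. card ?V)"
    by (rule sum_mono) (rule few)
  also have "\<dots> = k ^ card ?V * card ?V"
    by (simp add: cardC)
  finally have "card (L k) * k ^ card ?V \<le> (card ?V * k ^ k) * k ^ card ?V"
    by (simp add: ac_simps)
  then have "card (L k) \<le> card ?V * k ^ k"
    using k by simp
  then show ?thesis
    using paths by linarith
qed

section \<open>The generalised de Bruijn digraph\<close>

definition de_bruijn :: "nat \<Rightarrow> nat \<Rightarrow> nat pair_pre_digraph" where
  "de_bruijn n d = \<lparr> pverts = {..<n},
     parcs = {(i, j). i < n \<and> j < n \<and> i \<noteq> j \<and> (\<exists>r<d. j = (d * i + r) mod n)} \<rparr>"

lemma pair_digraph_de_bruijn: "pair_digraph (de_bruijn n d)"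
proof
  show "finite (parcs (de_bruijn n d))"
    by (rule finite_subset[of _ "{..<n} \<times> {..<n}"]) (auto simp: de_bruijn_def)
qed (auto simp: de_bruijn_def)

text \<open>The \<open>d\<close>-ary digits of \<open>s\<close> are the choices of \<open>r\<close> along the walk.\<close>

lemma de_bruijn_vwalk_code:
  assumes "vwalk p (with_proj (de_bruijn n d))" and "length p = Suc j"
  shows "\<exists>s<d ^ j. \<forall>i\<le>j. p ! i = (d ^ i * hd p + s div d ^ (j - i)) mod n"
  using assms
proof (induct j arbitrary: p)
  case 0
  then obtain a where "p = [a]"
    by (auto simp: length_Suc_conv)
  with 0 show ?case
    by (auto simp: vwalk_def de_bruijn_def)
next
  case (Suc j)
  obtain p' v where p: "p = p' @ [v]"
    using Suc.prems(2) by (cases p rule: rev_cases) auto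
  have len: "length p' = Suc j"
    using p Suc.prems(2) by simp
  then have ne: "p' \<noteq> []" by auto
  have w: "vwalk p' (with_proj (de_bruijn n d))" and arc: "(last p', v) \<in> parcs (de_bruijn n d)"
    using Suc.prems(1) vwalk_snoc_iff[OF ne pair_digraph_de_bruijn] by (simp_all add: p)
  obtain s where s: "s < d ^ j" "\<And>i. i \<le> j \<Longrightarrow> p' ! i = (d ^ i * hd p' + s div d ^ (j - i)) mod n"
    using Suc.hyps[OF w len] by blast
  obtain r where r: "r < d" "v = (d * last p' + r) mod n"
    using arc by (auto simp: de_bruijn_def)
  have last: "last p' = (d ^ j * hd p' + s) mod n"
    using s(2)[of j] len ne by (simp add: last_conv_nth)
  \<comment> \<open>The new choice \<open>r\<close> is appended to \<open>s\<close> as its last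
    digit.\<close>
  let ?s = "d * s + r"
  have "?s < d * Suc s"
    using r(1) by simp
  also have "\<dots> \<le> d * d ^ j"
    using s(1) by (intro mult_le_mono2) simp
  finally have "?s < d ^ Suc j" by simp
  moreover have "p ! i = (d ^ i * hd p + ?s div d ^ (Suc j - i)) mod n" if "i \<le> Suc j" for i
  proof (cases "i = Suc j")
    case True
    have "v = (d * (d ^ j * hd p' + s) + r) mod n"
      unfolding r(2) last by (metis mod_add_left_eq mod_mult_right_eq)
    then show ?thesis
      using True len ne by (simp add: p nth_append hd_append algebra_simps)
  next
    case False
    then have i: "i \<le> j" using that by simp
    \<comment> \<open>Dropping the digit \<open>r\<close> again recovers \<open>s\<close>, so the
      earlier vertices keep their formula.\<close>
    have "?s div d ^ (Suc j - i) = (?s div d) div d ^ (j - i)"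
      using i by (simp add: Suc_diff_le div_mult2_eq)
    also have "?s div d = s"
      using r(1) by simp
    finally show ?thesis
      using s(2)[OF i] i len ne by (simp add: p nth_append hd_append)
  qed
  ultimately show ?case by blast
qed

text \<open>Start and end fix the code modulo \<open>n\<close>. Codes are below
  \<open>d ^ k \<le> n\<close>, so the code itself is fixed, and with it every vertex.\<close>

lemma free_of_two_walks_de_bruijn:
  assumes "d ^ k \<le> n"
  shows "free_of (two_walks k :: nat pair_pre_digraph set) (de_bruijn n d)"
  unfolding free_of_two_walks_iff[OF pair_digraph_de_bruijn]
proof (intro allI impI)
  fix p q assume pq: "vwalk p (with_proj (de_bruijn n d))" "vwalk q (with_proj (de_bruijn n d))"
    "length p = Suc k" "length q = Suc k" "hd p = hd q" "last p = last q"
  obtain s where s: "s < d ^ k" "\<And>i. i \<le> k \<Longrightarrow> p ! i = (d ^ i * hd p + s div d ^ (k - i)) mod n"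
    using de_bruijn_vwalk_code[OF pq(1,3)] by blast
  obtain t where t: "t < d ^ k" "\<And>i. i \<le> k \<Longrightarrow> q ! i = (d ^ i * hd q + t div d ^ (k - i)) mod n"
    using de_bruijn_vwalk_code[OF pq(2,4)] by blast
  have "p ! k = q ! k"
    using pq(3,4,6) by (metis diff_Suc_1 last_conv_nth list.size(3) nat.distinct(1))
  then have "(d ^ k * hd p + s) mod n = (d ^ k * hd p + t) mod n"
    using s(2)[of k] t(2)[of k] pq(5) by simp
  then have "[s = t] (mod n)"
    by (simp add: cong_def [symmetric] cong_add_lcancel_nat)
  then have "s = t"
    using s(1) t(1) assms by (simp add: cong_def)
  then show "p = q"
    using s(2) t(2) pq(3-5) by (intro nth_equalityI) auto
qed

text \<open>Before loops are removed, out-neighbours are \<open>d\<close> consecutive residues,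
  distinct since \<open>d \<le> n\<close>, and at least \<open>d\<close> in-neighbours come from
  division by \<open>d\<close>. A loop accounts for the \<open>1\<close> subtracted.\<close>

lemma min_semidegree_de_bruijn:
  assumes "d \<le> n" and "0 < n"
  shows "d - 1 \<le> min_semidegree (de_bruijn n d)"
proof -
  have out: "d - 1 \<le> card {j. (i, j) \<in> parcs (de_bruijn n d)}" if i: "i < n" for i
  proof -
    let ?J = "(\<lambda>r. (d * i + r) mod n) ` {..<d}"
    have "inj_on (\<lambda>r. (d * i + r) mod n) {..<d}"
    proof (rule inj_onI)
      fix r s assume rs: "r \<in> {..<d}" "s \<in> {..<d}" "(d * i + r) mod n = (d * i + s) mod n"
      then have "[r = s] (mod n)"
        by (simp add: cong_def [symmetric] cong_add_lcancel_nat)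
      then show "r = s"
        using rs(1,2) assms(1) by (simp add: cong_def)
    qed
    then have "card ?J = d"
      by (simp add: card_image)
    moreover have "{j. (i, j) \<in> parcs (de_bruijn n d)} = ?J - {i}"
      using i assms(2) by (auto simp: de_bruijn_def)
    ultimately show ?thesis
      using diff_card_le_card_Diff[of "{i}" ?J] by simp
  qed
  have in': "d - 1 \<le> card {i. (i, j) \<in> parcs (de_bruijn n d)}" if j: "j < n" for j
  proof -
    \<comment> \<open>An in-neighbour \<open>i\<close> of \<open>j\<close> solves
      \<open>d * i + r = j + n * s\<close> with \<open>r < d\<close>, so it is a quotient by
      \<open>d\<close>. Successive numerators differ by \<open>n \<ge> d\<close>, which makes the
      quotients distinct; for \<open>s < d\<close> they stay below \<open>n\<close>.\<close>
    let ?f = "\<lambda>s. (j + n * s) div d"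
    have "strict_mono_on {..<d} ?f"
    proof (rule strict_mono_onI)
      fix s t assume st: "s \<in> {..<d}" "t \<in> {..<d}" "s < t"
      have "n * s + n \<le> n * t"
        using mult_le_mono2[of "Suc s" t n] st(3) by simp
      then have "(j + n * s) + d \<le> j + n * t"
        using assms(1) by linarith
      then have "((j + n * s) + d) div d \<le> ?f t"
        by (rule div_le_mono)
      then show "?f s < ?f t"
        using st by simp
    qed
    then have "card (?f ` {..<d}) = d"
      by (simp add: card_image strict_mono_on_imp_inj_on)
    moreover have "?f ` {..<d} - {j} \<subseteq> {i. (i, j) \<in> parcs (de_bruijn n d)}"
    proof
      fix i assume "i \<in> ?f ` {..<d} - {j}"
      then obtain s where s: "s < d" "i = (j + n * s) div d" "i \<noteq> j" by auto
      have "j + n * s < n * Suc s"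
        using j by simp
      also have "\<dots> \<le> n * d"
        using s(1) by (intro mult_le_mono2) simp
      finally have "i < n"
        unfolding s(2) by (simp add: less_mult_imp_div_less)
      moreover have "j = (d * i + (j + n * s) mod d) mod n"
        using j by (simp add: s(2))
      moreover have "(j + n * s) mod d < d"
        using s(1) by simp
      ultimately show "i \<in> {i. (i, j) \<in> parcs (de_bruijn n d)}"
        using s(3) j by (auto simp: de_bruijn_def)
    qed
    moreover have "finite {i. (i, j) \<in> parcs (de_bruijn n d)}"
      by (rule finite_subset[of _ "{..<n}"]) (auto simp: de_bruijn_def)
    ultimately show ?thesis
      using diff_card_le_card_Diff[of "{j}" "?f ` {..<d}"]
        card_mono[of "{i. (i, j) \<in> parcs (de_bruijn n d)}" "?f ` {..<d} - {j}"] by simp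
  qed
  have V: "pverts (de_bruijn n d) = {..<n}"
    by (simp add: de_bruijn_def)
  have "d - 1 \<le> min_out_degree (de_bruijn n d)"
    unfolding min_out_degree_def V
    by (rule Min.boundedI) (use out assms(2) in \<open>auto simp: out_degree_with_proj\<close>)
  moreover have "d - 1 \<le> min_in_degree (de_bruijn n d)"
    unfolding min_in_degree_def V
    by (rule Min.boundedI) (use in' assms(2) in \<open>auto simp: in_degree_with_proj\<close>)
  ultimately show ?thesis
    unfolding min_semidegree_def by (rule min.boundedI)
qed

section \<open>The extremal numbers and their explicit bounds\<close>

lemma min_semidegree_le_card:
  assumes "pair_digraph G" "pverts G \<noteq> {}"
  shows "min_semidegree G \<le> card (pverts G)"
  using min_out_degree_le_card[OF assms] by (simp add: min_semidegree_def)

text \<open>The bound makes the set of values finite and \<open>x\<close> makes it nonempty, so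
  \<open>Max\<close> is a genuine maximum.\<close>

lemma Max_attained:
  fixes f :: "'a \<Rightarrow> nat"
  assumes "P x" and bound: "\<And>y. P y \<Longrightarrow> f y \<le> n"
  shows "f x \<le> Max {f y | y. P y}" and "\<exists>y. P y \<and> f y = Max {f y | y. P y}"
proof -
  have fin: "finite {f y | y. P y}"
    by (rule finite_subset[of _ "{..n}"]) (use bound in auto)
  have x: "f x \<in> {f y | y. P y}"
    using \<open>P x\<close> by blast
  show "f x \<le> Max {f y | y. P y}"
    by (rule Max_ge[OF fin x])
  have "Max {f y | y. P y} \<in> {f y | y. P y}"
    using x by (intro Max_in[OF fin]) blast
  then obtain y where "P y" "f y = Max {f y | y. P y}"
    by force
  then show "\<exists>y. P y \<and> f y = Max {f y | y. P y}"
    by blast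
qed

text \<open>The given \<open>G\<close> shows that the set of degrees is nonempty. Positivity of
  \<open>n\<close> excludes the empty host, whose \<open>Min\<close> is unspecified.\<close>

lemma max_min_out_degree_attained:
  fixes G :: "nat pair_pre_digraph"
  assumes G: "pair_digraph G" "card (pverts G) = n" "free_of F G" and n: "0 < n"
  shows max_min_out_degree_ge: "min_out_degree G \<le> max_min_out_degree n F"
    and "\<exists>G' :: nat pair_pre_digraph.
      (pair_digraph G' \<and> card (pverts G') = n \<and> free_of F G') \<and>
      min_out_degree G' = max_min_out_degree n F"
proof -
  let ?P = "\<lambda>G. pair_digraph G \<and> card (pverts G) = n \<and> free_of F G"
  have P: "pair_digraph G \<and> card (pverts G) = n \<and> free_of F G"
    using G by blast
  have bound: "min_out_degree H \<le> n" if "pair_digraph H \<and> card (pverts H) = n \<and> free_of F H"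
    for H :: "nat pair_pre_digraph"
  proof -
    have "pverts H \<noteq> {}"
      using that n by (metis card.empty less_irrefl)
    then show ?thesis
      using min_out_degree_le_card[of H] that by simp
  qed
  show "min_out_degree G \<le> max_min_out_degree n F"
    unfolding max_min_out_degree_def
    by (rule Max_attained(1)[where P = ?P and n = n])
      (rule P, rule bound)
  show "\<exists>G' :: nat pair_pre_digraph.
      (pair_digraph G' \<and> card (pverts G') = n \<and> free_of F G') \<and>
      min_out_degree G' = max_min_out_degree n F"
    unfolding max_min_out_degree_def
    by (rule Max_attained(2)[where P = ?P and x = G and n = n])
      (rule P, rule bound)
qed

lemma max_min_semidegree_attained:
  fixes G :: "nat pair_pre_digraph"
  assumes G: "pair_digraph G" "card (pverts G) = n" "free_of F G" and n: "0 < n"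
  shows max_min_semidegree_ge: "min_semidegree G \<le> max_min_semidegree n F"
    and "\<exists>G' :: nat pair_pre_digraph.
      (pair_digraph G' \<and> card (pverts G') = n \<and> free_of F G') \<and>
      min_semidegree G' = max_min_semidegree n F"
proof -
  let ?P = "\<lambda>G. pair_digraph G \<and> card (pverts G) = n \<and> free_of F G"
  have P: "pair_digraph G \<and> card (pverts G) = n \<and> free_of F G"
    using G by blast
  have bound: "min_semidegree H \<le> n" if "pair_digraph H \<and> card (pverts H) = n \<and> free_of F H"
    for H :: "nat pair_pre_digraph"
  proof -
    have "pverts H \<noteq> {}"
      using that n by (metis card.empty less_irrefl)
    then show ?thesis
      using min_semidegree_le_card[of H] that by simp
  qed
  show "min_semidegree G \<le> max_min_semidegree n F"
    unfolding max_min_semidegree_def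
    by (rule Max_attained(1)[where P = ?P and n = n])
      (rule P, rule bound)
  show "\<exists>G' :: nat pair_pre_digraph.
      (pair_digraph G' \<and> card (pverts G') = n \<and> free_of F G') \<and>
      min_semidegree G' = max_min_semidegree n F"
    unfolding max_min_semidegree_def
    by (rule Max_attained(2)[where P = ?P and x = G and n = n])
      (rule P, rule bound)
qed

lemma degree_bounds:
  fixes k n :: nat
  defines "x \<equiv> real n powr (1 / real k)"
  assumes "0 < k" and "2 < x"
  shows "x - 2 \<le> real (max_min_semidegree n (two_walks k))"
    and "max_min_semidegree n (two_walks k) \<le> max_min_out_degree n (two_walks k)"
    and "max_min_semidegree n (two_walks k) \<le> max_min_out_degree n (two_paths_upto k)"
    and "real (max_min_out_degree n (two_walks k)) \<le> x"
    and "real (max_min_out_degree n (two_paths_upto k)) \<le> real k * x + real k"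
proof -
  let ?F = "two_walks k :: nat pair_pre_digraph set"
  let ?C = "two_paths_upto k :: nat pair_pre_digraph set"
  \<comment> \<open>For \<open>n = 0\<close> the power \<open>x\<close> would be \<open>0\<close>,
    because \<open>0 powr y = 0\<close>.\<close>
  have n: "0 < n"
    using assms(3) by (cases n) (auto simp: x_def)
  have xk: "x ^ k = real n"
    using n assms(2) by (simp add: x_def flip: powr_realpow) (simp add: powr_powr)
  define d where "d = nat \<lfloor>x\<rfloor>"
  have d: "real d \<le> x" "x - 1 < real d"
    using assms(3) by (simp_all add: d_def)
  have "real (d ^ k) \<le> real n"
    using power_mono[OF d(1), of k] by (simp add: xk)
  then have dk: "d ^ k \<le> n"
    by linarith
  have "d \<le> d ^ k"
    using assms(2) by (cases d) (auto intro: self_le_power)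
  then have dn: "d \<le> n" using dk by simp
  have cardB: "card (pverts (de_bruijn n d)) = n"
    by (simp add: de_bruijn_def)
  note B = pair_digraph_de_bruijn cardB free_of_two_walks_de_bruijn[OF dk] n
  have "d - 1 \<le> max_min_semidegree n (two_walks k)"
    using min_semidegree_de_bruijn[OF dn n] max_min_semidegree_ge[OF B] by linarith
  then show low: "x - 2 \<le> real (max_min_semidegree n (two_walks k))"
    using d(2) by linarith
  \<comment> \<open>This host attains the largest semidegree; it is reused as a competitor for both
    outdegree maxima.\<close>
  obtain G :: "nat pair_pre_digraph" where G: "pair_digraph G" "card (pverts G) = n" "free_of ?F G"
    "min_semidegree G = max_min_semidegree n (two_walks k)"
    using max_min_semidegree_attained(2)[OF B] by blast
  have out: "max_min_semidegree n (two_walks k) \<le> min_out_degree G"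
    using G(4) by (simp add: min_semidegree_def)
  \<comment> \<open>Here \<open>2 < x\<close> enters: a positive outdegree is what lets freeness
    from pairs of walks imply freeness from pairs of paths.\<close>
  have "0 < min_out_degree G"
    using low assms(3) out by linarith
  then have freeG: "free_of ?C G"
    using free_of_two_walks_imp_two_paths_upto[OF G(1) _ G(3)] by blast
  show "max_min_semidegree n (two_walks k) \<le> max_min_out_degree n (two_walks k)"
    using out max_min_out_degree_ge[OF G(1-3) n] by linarith
  show "max_min_semidegree n (two_walks k) \<le> max_min_out_degree n (two_paths_upto k)"
    using out max_min_out_degree_ge[OF G(1,2) freeG n] by linarith
  have x0: "0 \<le> x" using assms(3) by simp
  obtain G1 :: "nat pair_pre_digraph" where G1: "pair_digraph G1" "card (pverts G1) = n" "free_of ?F G1"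
    "min_out_degree G1 = max_min_out_degree n (two_walks k)"
    using max_min_out_degree_attained(2)[OF G(1-3) n] by blast
  have "pverts G1 \<noteq> {}" using G1(2) n by auto
  then have "max_min_out_degree n (two_walks k) ^ k \<le> n"
    using min_out_degree_power_le_card[OF G1(1) _ G1(3)] G1(2,4) by simp
  then have "real (max_min_out_degree n (two_walks k)) ^ k \<le> x ^ k"
    unfolding xk by (simp flip: of_nat_power)
  then show "real (max_min_out_degree n (two_walks k)) \<le> x"
    using x0 assms(2) by simp
  obtain G2 :: "nat pair_pre_digraph" where G2: "pair_digraph G2" "card (pverts G2) = n" "free_of ?C G2"
    "min_out_degree G2 = max_min_out_degree n (two_paths_upto k)"
    using max_min_out_degree_attained(2)[OF G(1,2) freeG n] by blast
  let ?D = "max_min_out_degree n (two_paths_upto k)"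
  have "pverts G2 \<noteq> {}" using G2(2) n by auto
  then have "(?D - k) ^ k \<le> n * k ^ k"
    using two_paths_upto_free_degree_bound[OF G2(1) _ assms(2) G2(3)] G2(2,4) by simp
  then have "real ((?D - k) ^ k) \<le> real (n * k ^ k)"
    by (simp only: of_nat_le_iff)
  then have "real (?D - k) ^ k \<le> (real k * x) ^ k"
    by (simp add: power_mult_distrib xk mult.commute)
  then have "real (?D - k) \<le> real k * x"
    using x0 assms(2) by simp
  \<comment> \<open>Even with truncated subtraction, \<open>?D \<le> (?D - k) + k\<close>.\<close>
  then show "real ?D \<le> real k * x + real k"
    by linarith
qed

theorem theorem1p12:
  fixes k :: nat
  assumes "k \<ge> 2"
  shows "\<exists>e1 e2 e3 :: nat \<Rightarrow> real.
    e1 \<in> o(\<lambda>_. 1) \<and> e2 \<in> o(\<lambda>_. 1) \<and> e3 \<in> o(\<lambda>_. 1) \<and>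
    (\<forall>\<^sub>F n in sequentially.
       (1 / real k powr (1 + 1 / real k) - e1 n) * real n powr (1 / real k)
         \<le> real (max_min_semidegree n (two_walks k)) \<and>
       max_min_semidegree n (two_walks k) \<le> max_min_out_degree n (two_paths_upto k) \<and>
       real (max_min_out_degree n (two_paths_upto k))
         \<le> (2 * real k + e2 n) * real (max_min_out_degree n (two_walks k)) \<and>
       (2 * real k + e2 n) * real (max_min_out_degree n (two_walks k))
         \<le> (2 * real k + e3 n) * real n powr (1 / real k))"
proof -
  have "real k powr 1 \<le> real k powr (1 + 1 / real k)"
    using assms by (intro powr_mono) auto
  then have "2 \<le> real k powr (1 + 1 / real k)"
    using assms by simp
  then have c: "1 / real k powr (1 + 1 / real k) \<le> 1 / 2"
    by (rule divide_left_mono) (use assms in simp_all)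
  \<comment> \<open>The threshold gives \<open>x \<ge> 5\<close> for
    \<open>x = n powr (1 / k)\<close>. Then \<open>x / 2 \<le> x - 2\<close>, and
    \<open>k * x + k \<le> 2 * k * (x - 2)\<close>, which for positive \<open>k\<close> is
    equivalent to \<open>x \<ge> 5\<close>.\<close>
  have "\<forall>\<^sub>F n in sequentially. 5 ^ k \<le> n"
    by (rule eventually_ge_at_top)
  then have "\<forall>\<^sub>F n in sequentially. 5 \<le> real n powr (1 / real k)"
  proof eventually_elim
    case (elim n)
    have "(5 :: real) = (5 ^ k) powr (1 / real k)"
      using assms by (simp add: powr_powr flip: powr_realpow)
    also have "\<dots> \<le> real n powr (1 / real k)"
      using of_nat_mono[OF elim, where 'a = real] by (intro powr_mono2) simp_all
    finally show ?case .
  qed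
  then have "\<forall>\<^sub>F n in sequentially.
       (1 / real k powr (1 + 1 / real k) - 0) * real n powr (1 / real k)
         \<le> real (max_min_semidegree n (two_walks k)) \<and>
       max_min_semidegree n (two_walks k) \<le> max_min_out_degree n (two_paths_upto k) \<and>
       real (max_min_out_degree n (two_paths_upto k))
         \<le> (2 * real k + 0) * real (max_min_out_degree n (two_walks k)) \<and>
       (2 * real k + 0) * real (max_min_out_degree n (two_walks k))
         \<le> (2 * real k + 0) * real n powr (1 / real k)"
  proof eventually_elim
    case (elim n)
    define x where "x = real n powr (1 / real k)"
    have x: "5 \<le> x" using elim by (simp add: x_def)
    have b: "x - 2 \<le> real (max_min_semidegree n (two_walks k))"
      "max_min_semidegree n (two_walks k) \<le> max_min_out_degree n (two_walks k)"
      "max_min_semidegree n (two_walks k) \<le> max_min_out_degree n (two_paths_upto k)"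
      "real (max_min_out_degree n (two_walks k)) \<le> x"
      "real (max_min_out_degree n (two_paths_upto k)) \<le> real k * x + real k"
      using degree_bounds[of k n] assms x by (auto simp: x_def)
    have "1 / real k powr (1 + 1 / real k) * x \<le> 1 / 2 * x"
      using c x by (intro mult_right_mono) auto
    then have "1 / real k powr (1 + 1 / real k) * x \<le> real (max_min_semidegree n (two_walks k))"
      using b(1) x by linarith
    moreover have "real k * x + real k \<le> 2 * real k * (x - 2)"
      using mult_left_mono[OF x, of "real k"] by (simp add: algebra_simps)
    moreover have "2 * real k * (x - 2) \<le> 2 * real k * real (max_min_out_degree n (two_walks k))"
      using b(1,2) by (intro mult_left_mono) auto
    moreover have "2 * real k * real (max_min_out_degree n (two_walks k)) \<le> 2 * real k * x"
      using b(4) by (intro mult_left_mono) auto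
    ultimately show ?case
      using b(3,5) by (simp flip: x_def)
  qed
  then show ?thesis
    by (intro exI[of _ "\<lambda>_. 0"]) simp
qed

end
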